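(* Let $W$ be an irreducible $T$-module with endpoint $r$ and diameter $d=D-2r$. Then the following hold for $0\le i,j\le d$ and nonzero vectors $u\in E_rW$, $u^*\in E^*_rW$, $u^{\varepsilon}\in E^{\varepsilon}_rW$. (i) $$\langle E_{r+i}u^*,E^*_{r+j}u\rangle=2^{-d}\langle u^*,u\rangle\binom{d}{i}\binom{d}{j}\;{}_2F_1\Big({-i,-j\atop -d};2\Big).$$ (ii) $$\langle E^*_{r+i}u^{\varepsilon},E^{\varepsilon}_{r+j}u^*\rangle=2^{-d}\langle u^{\varepsilon},u^*\rangle\binom{d}{i}\binom{d}{j}\;{}_2F_1\Big({-i,-j\atop -d};2\Big).$$ (iii) $$\langle E^{\varepsilon}_{r+i}u,E_{r+j}u^{\varepsilon}\rangle=2^{-d}\langle u,u^{\varepsilon}\rangle\binom{d}{i}\binom{d}{j}\;{}_2F_1\Big({-i,-j\atop -d};2\Big).$$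
   Context: Let $D$ be a positive integer and let $Q_D$ be the $D$-cube: the graph with vertex set $X=\{0,1\}^D$, two vertices being adjacent iff they differ in exactly one coordinate; $\partial$ denotes path-length distance. $\mathrm{Mat}_X(\mathbb{C})$ is the algebra of complex matrices with rows and columns indexed by $X$, acting on $V=\mathbb{C}^X$ (column vectors) by left multiplication. $V$ carries the Hermitian inner product $\langle v,w\rangle=v^t\overline{w}$ (linear in the first argument). Write $\mathbf{i}^2=-1$ (the bold $\mathbf{i}$ is the imaginary unit; the plain $i$ is an index). Let $A$ be the adjacency matrix of $Q_D$. Fix $x=(0,0,\ldots,0)\in X$. Let $A^*$ be the diagonal matrix in $\mathrm{Mat}_X(\mathbb{C})$ with $(y,y)$-entry $D-2\partial(x,y)$ for $y\in X$, and let $A^{\varepsilon}=-\mathbf{i}(AA^*-A^*A)/2$. Let $T$ be the subalgebra of $\mathrm{Mat}_X(\mathbb{C})$ generated by $A$ and $A^*$. The eigenvalues of $A$ are $\theta_i=D-2i$ $(0\le i\le D)$. For $0\le i\le D$: $E_i=\prod_{0\le j\le D,\,j\ne i}\frac{A-\theta_jI}{\theta_i-\theta_j}$ is the primitive idempotent of $A$ for $\theta_i$ (the orthogonal projection onto the $\theta_i$-eigenspace of $A$); $E_i^*$ is the diagonal matrix with $(y,y)$-entry $1$ if $\partial(x,y)=i$ and $0$ otherwise; and $E_i^{\varepsilon}=P^{-1}E_iP$, where $P=P_1^{\otimes D}$ (Kronecker power, $P_{yz}=\prod_{k=1}^D(P_1)_{y_kz_k}$, invertible) with $P_1=\begin{pmatrix}1&1\\-\mathbf{i}&\mathbf{i}\end{pmatrix}$,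 rows and columns indexed by $0,1$ in that order. ($E_i^*$ and $E_i^{\varepsilon}$ are the primitive idempotents of $A^*$ and $A^{\varepsilon}$ for the eigenvalue $D-2i$.) A $T$-module is a subspace $W\subseteq V$ with $BW\subseteq W$ for all $B\in T$; it is irreducible if $W\ne0$ and it contains no $T$-modules other than $0$ and $W$. The endpoint of an irreducible $T$-module $W$ is $r=\min\{i\mid 0\le i\le D,\ E_i^*W\neq0\}$ (it is known that also $r=\min\{i\mid E_iW\ne0\}$), and its diameter is $d=|\{i\mid 0\le i\le D,\ E_i^*W\ne0\}|-1$; it is known that $d=D-2r$ and $0\le r\le D/2$. For $a\in\mathbb{C}$ and an integer $n\ge0$, $(a)_n=a(a+1)\cdots(a+n-1)$ with $(a)_0=1$. For integers $0\le i,j\le d$, ${}_2F_1\big({-i,-j\atop -d};2\big)=\sum_{n=0}^d\frac{(-i)_n(-j)_n}{(-d)_n\,n!}2^n$. *)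

theory Defs
  imports "HOL-Analysis.Analysis"
begin

text \<open>
  The dimension \<open>D\<close> is \<open>CARD('n)\<close>, which is positive because types are nonempty.
  Coordinates are indexed by \<open>'n\<close>, and \<open>False\<close>, \<open>True\<close> stand for the coordinate values 0, 1.
\<close>

type_synonym 'n vertex = "bool ^ 'n"
type_synonym 'n cvec = "complex ^ 'n vertex"
type_synonym 'n cmat = "complex ^ 'n vertex ^ 'n vertex"

definition cube_adj :: "'n::finite vertex \<Rightarrow> 'n vertex \<Rightarrow> bool" where
  "cube_adj y z \<longleftrightarrow> card {k. y $ k \<noteq> z $ k} = 1"

definition cube_dist :: "'n::finite vertex \<Rightarrow> 'n vertex \<Rightarrow> nat" where
  "cube_dist y z = (LEAST n. (cube_adj ^^ n) y z)"

definition base_vertex :: "'n::finite vertex" where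
  "base_vertex = (\<chi> k. False)"

definition herm :: "'n::finite cvec \<Rightarrow> 'n cvec \<Rightarrow> complex" where
  "herm v w = (\<Sum>y\<in>UNIV. v $ y * cnj (w $ y))"

definition mscale :: "complex \<Rightarrow> 'n::finite cmat \<Rightarrow> 'n cmat" where
  "mscale c M = (\<chi> y z. c * M $ y $ z)"

definition theta :: "'n::finite itself \<Rightarrow> nat \<Rightarrow> complex" where
  "theta _ i = of_nat CARD('n) - 2 * of_nat i"

definition adjA :: "'n::finite cmat" where
  "adjA = (\<chi> y z. if cube_adj y z then 1 else 0)"

definition dualA :: "'n::finite cmat" where
  "dualA = (\<chi> y z. if y = z
     then of_nat CARD('n) - 2 * of_nat (cube_dist base_vertex y) else 0)"

definition is_subalgebra :: "'n::finite cmat set \<Rightarrow> bool" where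
  "is_subalgebra S \<longleftrightarrow> mat 1 \<in> S \<and>
     (\<forall>B\<in>S. \<forall>C\<in>S. B + C \<in> S \<and> B ** C \<in> S) \<and>
     (\<forall>c. \<forall>B\<in>S. mscale c B \<in> S)"

definition algT :: "'n::finite cmat set" where
  "algT = is_subalgebra hull {adjA, dualA}"

text \<open>
  The type of matrices has no \<open>comm_monoid_mult\<close> structure for \<open>**\<close> (its \<open>*\<close> is entrywise), so
  the product over all \<open>j \<noteq> i\<close> is taken over a list, in increasing order of \<open>j\<close>.
\<close>

definition idE :: "nat \<Rightarrow> 'n::finite cmat" where
  "idE i = foldr (**)
     (map (\<lambda>j. mscale (1 / (theta TYPE('n) i - theta TYPE('n) j))
                 (adjA - mscale (theta TYPE('n) j) (mat 1)))
        (filter (\<lambda>j. j \<noteq> i) [0..<Suc CARD('n)]))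
     (mat 1)"

definition dualE :: "nat \<Rightarrow> 'n::finite cmat" where
  "dualE i = (\<chi> y z. if y = z \<and> cube_dist base_vertex y = i then 1 else 0)"

definition P1 :: "complex ^ bool ^ bool" where
  "P1 = (\<chi> a b. if a then (if b then \<i> else - \<i>) else 1)"

definition matP :: "'n::finite cmat" where
  "matP = (\<chi> y z. \<Prod>k\<in>UNIV. P1 $ (y $ k) $ (z $ k))"

definition epsE :: "nat \<Rightarrow> 'n::finite cmat" where
  "epsE i = matrix_inv matP ** idE i ** matP"

definition img :: "'n::finite cmat \<Rightarrow> 'n cvec set \<Rightarrow> 'n cvec set" where
  "img B W = (\<lambda>w. B *v w) ` W"

definition T_module :: "'n::finite cvec set \<Rightarrow> bool" where
  "T_module W \<longleftrightarrow> vec.subspace W \<and> (\<forall>B\<in>algT. img B W \<subseteq> W)"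

definition irreducible_T_module :: "'n::finite cvec set \<Rightarrow> bool" where
  "irreducible_T_module W \<longleftrightarrow> T_module W \<and> W \<noteq> {0} \<and>
     (\<forall>U. T_module U \<and> U \<subseteq> W \<longrightarrow> U = {0} \<or> U = W)"

definition endpoint :: "'n::finite cvec set \<Rightarrow> nat" where
  "endpoint W = Min {i. i \<le> CARD('n) \<and> img (dualE i) W \<noteq> {0}}"

definition diameter_T :: "'n::finite cvec set \<Rightarrow> nat" where
  "diameter_T W = card {i. i \<le> CARD('n) \<and> img (dualE i) W \<noteq> {0}} - 1"

text \<open>The terminating series \<open>2F1(-i, -j; -d; 2)\<close>, truncated at \<open>n = d\<close> so that
  \<open>pochhammer (-d) n\<close> is nonzero in every term.\<close>

definition hyp2F1 :: "nat \<Rightarrow> nat \<Rightarrow> nat \<Rightarrow> complex" where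
  "hyp2F1 d i j = (\<Sum>n\<le>d. pochhammer (- of_nat i) n * pochhammer (- of_nat j) n
     / (pochhammer (- of_nat d) n * fact n) * 2 ^ n)"

end

theory Submission
  imports Defs
begin

text \<open>
  The matrices \<open>A\<close>, \<open>A\<^sup>*\<close>, \<open>A\<^sup>\<epsilon>\<close> are Hermitian, satisfy cyclic \<open>sl\<^sub>2\<close> commutation relations, and
  conjugation by \<open>P\<close> permutes them cyclically, so the three parts are instances of one statement about
  a triple \<open>X, Y, Z\<close> with raising and lowering operators \<open>(Y \<mp> \<i>Z)/2\<close> relative to \<open>X\<close>.
  For an \<open>X\<close>-highest weight vector \<open>v\<close> of weight \<open>d\<close> put \<open>v\<^sub>j = lower\<^sup>j v / j!\<close>. The vectors
  \<open>w\<^sub>i = (\<Sum>j\<le>d. F(i,j) v\<^sub>j)\<close>, where \<open>F\<close> is the hypergeometric sum, are \<open>Y\<close>-eigenvectors by the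
  three-term recurrence of \<open>F\<close>, and \<open>v = 2\<^sup>-\<^sup>d (\<Sum>i\<le>d. (d choose i) w\<^sub>i)\<close>; this gives the
  \<open>Y\<close>-components of \<open>v\<close>. If \<open>Y u = d u\<close>, then \<open>\<langle>v\<^sub>j,u\<rangle> = (d choose j) \<langle>v,u\<rangle>\<close> by adjointness.

  On an irreducible module the Casimir operator \<open>X\<^sup>2 + Y\<^sup>2 + Z\<^sup>2\<close> is the scalar \<open>d (d + 2)\<close>. It is
  the same for all three triples, so every \<open>X\<close>-, \<open>Y\<close>- or \<open>Z\<close>-eigenvector of weight \<open>d\<close> in the module
  is a highest weight vector, although the endpoint is defined through \<open>A\<^sup>*\<close> only.
\<close>

section \<open>The terminating hypergeometric sum\<close>

lemma pochhammer_minus_nat: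
  "pochhammer (- of_nat i :: complex) n = (- 1) ^ n * fact n * of_nat (i choose n)"
  by (simp add: binomial_gbinomial gbinomial_pochhammer flip: power_add mult.assoc)

text \<open>The three signs leave a single \<open>(- 1) ^ n\<close>, absorbed into
  \<open>(- 2) ^ n\<close>, and all factorials cancel. In this form the vanishing of terms beyond
  \<open>i\<close> or \<open>j\<close> is visible.\<close>

lemma hyp2F1_binomial:
  "hyp2F1 d i j =
     (\<Sum>n\<le>d. (- 2) ^ n * of_nat (i choose n) * of_nat (j choose n) / of_nat (d choose n))"
  unfolding hyp2F1_def
proof (rule sum.cong)
  fix n assume "n \<in> {..d}"
  then have "of_nat (d choose n) \<noteq> (0 :: complex)" by simp
  moreover have "(- 2 :: complex) ^ n = (- 1) ^ n * 2 ^ n"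
    by (simp flip: power_mult_distrib)
  ultimately show "pochhammer (- of_nat i) n * pochhammer (- of_nat j) n /
       (pochhammer (- of_nat d) n * fact n) * 2 ^ n =
       (- 2 :: complex) ^ n * of_nat (i choose n) * of_nat (j choose n) / of_nat (d choose n)"
    by (simp add: pochhammer_minus_nat divide_simps)
qed simp

text \<open>Stated over the complex numbers so that the difference is not truncated; for
  \<open>n > m\<close> both binomials vanish.\<close>

lemma of_nat_binomial_Suc:
  "of_nat (Suc n) * of_nat (m choose Suc n) = (of_nat m - of_nat n) * (of_nat (m choose n) :: complex)"
proof (cases "n \<le> m")
  case True
  have "Suc n * (m choose Suc n) = (m - n) * (m choose n)"
    using binomial_absorb_comp[of m n] binomial_absorption[of n m]
    by (cases m) (auto simp: binomial_absorption)
  then have "of_nat (Suc n * (m choose Suc n)) = (of_nat ((m - n) * (m choose n)) :: complex)"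
    by simp
  then show ?thesis using True by (simp only: of_nat_mult of_nat_diff)
qed (simp add: binomial_eq_0)

text \<open>The Krawtchouk three-term recurrence, proved by telescoping in the summation index. At
  \<open>j = 0\<close> the truncated \<open>j - 1\<close> is harmless because its coefficient is
  0.\<close>

lemma hyp2F1_recurrence:
  assumes "i \<le> d"
  shows "of_nat j * hyp2F1 d i (j - 1) + (of_nat d - of_nat j) * hyp2F1 d i (Suc j)
       = (of_nat d - 2 * of_nat i) * hyp2F1 d i j"
proof -
  define g :: "nat \<Rightarrow> complex"
    where "g n = (- 2) ^ n * of_nat (i choose n) / of_nat (d choose n)" for n
  \<comment> \<open>The telescoping certificate: each summand of the recurrence equals
    \<open>G n - G (Suc n)\<close>. The case \<open>n = 0\<close> guards the truncated
    \<open>n - 1\<close>.\<close>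
  define G :: "nat \<Rightarrow> complex"
    where "G n = of_nat n * g n * of_nat (j choose n)
      + (of_nat d - of_nat j) * (if n = 0 then 0 else g n * of_nat (j choose (n - 1)))" for n
  have F: "hyp2F1 d i l = (\<Sum>n\<le>d. g n * of_nat (l choose n))" for l
    unfolding hyp2F1_binomial g_def by (simp add: mult_ac)
  \<comment> \<open>Term ratio, cleared of denominators so that it survives \<open>n = d\<close>:
    there the left side is 0, and \<open>g d\<close> vanishes unless \<open>i = d\<close>.\<close>
  have g: "(of_nat d - of_nat n) * g (Suc n) = - 2 * (of_nat i - of_nat n) * g n" if "n \<le> d" for n
  proof (cases "n = d")
    case True
    then show ?thesis using assms by (cases "i = d") (auto simp: g_def)
  next
    case False
    then have "n < d" using that by simp
    then have nz: "of_nat (d choose n) \<noteq> (0::complex)" "of_nat (d choose Suc n) \<noteq> (0::complex)"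
      by simp_all
    have nz': "of_nat d - of_nat n \<noteq> (0::complex)" "of_nat (Suc n) \<noteq> (0::complex)"
      using \<open>n < d\<close> by (simp, simp del: of_nat_Suc)
    have e1: "of_nat (d choose Suc n) = (of_nat d - of_nat n) * (of_nat (d choose n) :: complex) / of_nat (Suc n)"
      using of_nat_binomial_Suc[of n d] nz' by (simp add: field_simps del: of_nat_Suc)
    have e2: "of_nat (i choose Suc n) = (of_nat i - of_nat n) * (of_nat (i choose n) :: complex) / of_nat (Suc n)"
      using of_nat_binomial_Suc[of n i] nz' by (simp add: field_simps del: of_nat_Suc)
    show ?thesis
      unfolding g_def e1 e2 using nz(1) nz' by (simp add: divide_simps del: of_nat_Suc) (simp add: algebra_simps)
  qed
  have summand: "of_nat j * (g n * of_nat ((j - 1) choose n))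
      + (of_nat d - of_nat j) * (g n * of_nat (Suc j choose n))
      - (of_nat d - 2 * of_nat i) * (g n * of_nat (j choose n)) = G n - G (Suc n)"
    if "n \<le> d" for n
  proof -
    have 1: "of_nat j * of_nat ((j - 1) choose n) = (of_nat j - of_nat n) * (of_nat (j choose n) :: complex)"
      using of_nat_binomial_Suc[of n j] binomial_absorption[of n "j"]
      by (metis of_nat_mult)
    have 2: "of_nat (Suc j choose n) = (of_nat (j choose n) :: complex) + (if n = 0 then 0 else of_nat (j choose (n - 1)))"
      by (cases n) simp_all
    have 3: "of_nat (Suc n) * of_nat (j choose Suc n) = (of_nat j - of_nat n) * (of_nat (j choose n) :: complex)"
      by (rule of_nat_binomial_Suc)
    have 4: "of_nat (Suc n) * g (Suc n) * of_nat (j choose Suc n) = g (Suc n) * (of_nat j - of_nat n) * of_nat (j choose n)"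
      using 3 by (metis mult.assoc mult.commute)
    have "G (Suc n) = ((of_nat d - of_nat n) * g (Suc n)) * of_nat (j choose n)"
      unfolding G_def 4 by (simp add: algebra_simps)
    then have 5: "G (Suc n) = - 2 * (of_nat i - of_nat n) * g n * of_nat (j choose n)"
      using g[OF that] by simp
    have "of_nat j * (g n * of_nat ((j - 1) choose n)) = g n * ((of_nat j - of_nat n) * of_nat (j choose n))"
      using 1 by (metis mult.left_commute)
    then show ?thesis
      unfolding 5 unfolding G_def 2 by (simp add: algebra_simps)
  qed
  have "of_nat j * hyp2F1 d i (j - 1) + (of_nat d - of_nat j) * hyp2F1 d i (Suc j)
       - (of_nat d - 2 * of_nat i) * hyp2F1 d i j = (\<Sum>n\<le>d. G n - G (Suc n))"
    unfolding F sum_distrib_left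
    by (subst sum.distrib[symmetric], subst sum_subtractf[symmetric], rule sum.cong)
      (use summand in auto)
  also have "\<dots> = G 0 - G (Suc d)"
    by (rule sum_telescope)
  \<comment> \<open>\<open>G 0\<close> is 0 by its explicit factors, and
    \<open>g (Suc d) = 0\<close> because \<open>i \<le> d\<close>.\<close>
  also have "\<dots> = 0"
    using assms by (simp add: G_def g_def binomial_eq_0)
  finally show ?thesis by simp
qed

text \<open>Choosing a subset of size \<open>n\<close> inside one of size \<open>i\<close> can be
  done in the reverse order; the remaining row sum is a power of 2.\<close>

lemma sum_binomial_product:
  assumes "n \<le> d"
  shows "(\<Sum>i\<le>d. (d choose i) * (i choose n)) = (d choose n) * 2 ^ (d - n)"
proof -
  have "(\<Sum>i\<le>d. (d choose i) * (i choose n)) = (\<Sum>i\<in>{n..d}. (d choose i) * (i choose n))"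
    by (rule sum.mono_neutral_right) auto
  also have "\<dots> = (\<Sum>i\<in>{n..d}. (d choose n) * ((d - n) choose (i - n)))"
    by (rule sum.cong) (auto simp: choose_mult)
  also have "\<dots> = (\<Sum>i\<le>d - n. (d choose n) * ((d - n) choose i))"
    by (rule sum.reindex_bij_witness[of _ "\<lambda>i. i + n" "\<lambda>i. i - n"]) (use assms in auto)
  finally show ?thesis
    by (simp add: choose_row_sum flip: sum_distrib_left)
qed

text \<open>After exchanging the sums, \<open>sum_binomial_product\<close> cancels the denominators
  and leaves \<open>2 ^ d\<close> times the alternating sum of row \<open>j\<close> of Pascal's
  triangle.\<close>

lemma hyp2F1_binomial_sum:
  assumes "j \<le> d"
  shows "(\<Sum>i\<le>d. of_nat (d choose i) * hyp2F1 d i j) = (if j = 0 then 2 ^ d else 0)"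
proof -
  have "(\<Sum>i\<le>d. of_nat (d choose i) * hyp2F1 d i j) =
    (\<Sum>n\<le>d. (- 2) ^ n * of_nat (j choose n) / of_nat (d choose n)
       * of_nat (\<Sum>i\<le>d. (d choose i) * (i choose n)))"
    unfolding hyp2F1_binomial sum_distrib_left of_nat_sum
    by (subst sum.swap) (simp add: mult_ac)
  also have "\<dots> = (\<Sum>n\<le>d. 2 ^ d * ((- 1) ^ n * of_nat (j choose n)))"
  proof (rule sum.cong)
    fix n assume n: "n \<in> {..d}"
    have "(- 2 :: complex) ^ n * 2 ^ (d - n) = (- 1) ^ n * (2 ^ n * 2 ^ (d - n))"
      by (simp add: power_minus[of 2 n])
    also have "\<dots> = (- 1) ^ n * 2 ^ d"
      using n by (simp flip: power_add)
    finally show "(- 2) ^ n * of_nat (j choose n) / of_nat (d choose n)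
       * of_nat (\<Sum>i\<le>d. (d choose i) * (i choose n)) = 2 ^ d * ((- 1) ^ n * (of_nat (j choose n) :: complex))"
      using n by (subst sum_binomial_product) (auto simp: field_simps)
  qed simp
  also have "\<dots> = 2 ^ d * (\<Sum>n\<le>j. (- 1) ^ n * of_nat (j choose n))"
    unfolding sum_distrib_left
    by (rule sum.mono_neutral_right) (use assms in auto)
  also have "\<dots> = (if j = 0 then 2 ^ d else 0)"
    using choose_alternating_sum[of j, where 'a = complex] by simp
  finally show ?thesis .
qed

section \<open>Hermitian form and Lagrange idempotents\<close>

lemma herm_add_left: "herm (v + w) z = herm v z + herm w z"
  by (simp add: herm_def algebra_simps sum.distrib)

lemma herm_add_right: "herm v (w + z) = herm v w + herm v z"
  by (simp add: herm_def algebra_simps sum.distrib)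

lemma herm_diff_left: "herm (v - w) z = herm v z - herm w z"
  by (simp add: herm_def algebra_simps sum_subtractf)

lemma herm_diff_right: "herm v (w - z) = herm v w - herm v z"
  by (simp add: herm_def algebra_simps sum_subtractf)

lemma herm_scale_left: "herm (c *s v) w = c * herm v w"
  by (simp add: herm_def algebra_simps sum_distrib_left)

lemma herm_scale_right: "herm v (c *s w) = cnj c * herm v w"
  by (simp add: herm_def algebra_simps sum_distrib_left)

lemma herm_zero_left [simp]: "herm 0 w = 0"
  by (simp add: herm_def)

lemma herm_zero_right [simp]: "herm w 0 = 0"
  by (simp add: herm_def)

lemma herm_sum_left: "herm (\<Sum>i\<in>I. v i) w = (\<Sum>i\<in>I. herm (v i) w)"
  by (induction I rule: infinite_finite_induct) (simp_all add: herm_add_left)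

lemma herm_sum_right: "herm w (\<Sum>i\<in>I. v i) = (\<Sum>i\<in>I. herm w (v i))"
  by (induction I rule: infinite_finite_induct) (simp_all add: herm_add_right)

lemmas herm_linear = herm_add_left herm_add_right herm_diff_left herm_diff_right
  herm_scale_left herm_scale_right

lemma herm_self: "herm w w = of_real ((norm w)\<^sup>2)"
  by (simp add: herm_def norm_vec_def L2_set_def sum_nonneg complex_norm_square del: of_real_power)

lemma matrix_vector_mult_sum_right:
  fixes M :: "'a::comm_ring_1 ^ 'n ^ 'm"
  shows "M *v (\<Sum>i\<in>I. v i) = (\<Sum>i\<in>I. M *v v i)"
  by (induction I rule: infinite_finite_induct) (simp_all add: matrix_vector_right_distrib)

lemmas mv_linear = matrix_vector_right_distrib matrix_vector_mult_diff_distrib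
  vector_scalar_commute

section \<open>Lagrange idempotents of diagonalizable matrices\<close>

lemma mscale_mult_vector: "mscale c M *v w = c *s (M *v w)"
  by (simp add: mscale_def vec_eq_iff matrix_vector_mult_def sum_distrib_left mult_ac)

text \<open>The formula of \<open>idE\<close> for an arbitrary matrix, so that \<open>idE\<close>,
  \<open>dualE\<close> and \<open>epsE\<close> can be treated as instances of one
  construction.\<close>

definition lagrange_idem :: "'n::finite cmat \<Rightarrow> nat \<Rightarrow> 'n cmat" where
  "lagrange_idem X i = foldr (**)
     (map (\<lambda>j. mscale (1 / (theta TYPE('n) i - theta TYPE('n) j))
                 (X - mscale (theta TYPE('n) j) (mat 1)))
        (filter (\<lambda>j. j \<noteq> i) [0..<Suc CARD('n)]))
     (mat 1)"

lemma theta_eq_iff [simp]: "theta TYPE('n::finite) i = theta TYPE('n) j \<longleftrightarrow> i = j"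
  by (simp add: theta_def)

lemma cnj_theta [simp]: "cnj (theta T i) = theta T i"
  by (simp add: theta_def)

text \<open>Each factor acts on an eigenvector as a scalar: all of these are 1 when
  \<open>i = k\<close>, and otherwise the factor with \<open>j = k\<close> is 0.\<close>

lemma lagrange_idem_eigenvector:
  fixes X :: "'n::finite cmat"
  assumes "X *v w = theta TYPE('n) k *s w" and "k \<le> CARD('n)"
  shows "lagrange_idem X i *v w = (if i = k then w else 0)"
proof -
  let ?t = "theta TYPE('n)"
  have "foldr (**) (map (\<lambda>j. mscale (1 / (?t i - ?t j)) (X - mscale (?t j) (mat 1))) js) (mat 1) *v w
      = prod_list (map (\<lambda>j. (?t k - ?t j) / (?t i - ?t j)) js) *s w" for js
  proof (induction js)
    case (Cons j js)
    have "(X - mscale (?t j) (mat 1)) *v w = (?t k - ?t j) *s w"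
      by (simp add: matrix_vector_mult_diff_rdistrib mscale_mult_vector assms vec_eq_iff algebra_simps)
    then show ?case
      using Cons by (simp add: mscale_mult_vector vector_scalar_commute vector_smult_assoc mult_ac
          flip: matrix_vector_mul_assoc)
        (simp add: vec_eq_iff diff_divide_distrib algebra_simps)
  qed simp
  moreover have "prod_list (map (\<lambda>j. (?t k - ?t j) / (?t i - ?t j)) (filter (\<lambda>j. j \<noteq> i) [0..<Suc CARD('n)]))
     = (if i = k then 1 else 0)"
  proof (cases "i = k")
    case True
    have "map (\<lambda>j. (?t k - ?t j) / (?t k - ?t j)) (filter (\<lambda>j. j \<noteq> k) [0..<Suc CARD('n)])
       = map (\<lambda>j. 1) (filter (\<lambda>j. j \<noteq> k) [0..<Suc CARD('n)])"
      by (rule map_cong) (auto simp del: upt_Suc)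
    then show ?thesis
      using True by (simp add: prod_list_replicate map_replicate_const del: upt_Suc)
  next
    case False
    have "k \<in> set (filter (\<lambda>j. j \<noteq> i) [0..<Suc CARD('n)])"
      using assms(2) False by auto
    then have "0 \<in> set (map (\<lambda>j. (?t k - ?t j) / (?t i - ?t j)) (filter (\<lambda>j. j \<noteq> i) [0..<Suc CARD('n)]))"
      by (metis (no_types, lifting) cancel_comm_monoid_add_class.diff_cancel div_0 image_eqI list.set_map)
    then show ?thesis
      using False by (simp add: prod_list_zero_iff del: upt_Suc set_map)
  qed
  ultimately show ?thesis
    unfolding lagrange_idem_def by (simp del: upt_Suc)
qed

lemma lagrange_idem_invariant:
  fixes X :: "'n::finite cmat"
  assumes "vec.subspace W" and "\<And>w. w \<in> W \<Longrightarrow> X *v w \<in> W" and "w \<in> W"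
  shows "lagrange_idem X i *v w \<in> W"
proof -
  let ?t = "theta TYPE('n)"
  have "foldr (**) (map (\<lambda>j. mscale (1 / (?t i - ?t j)) (X - mscale (?t j) (mat 1))) js) (mat 1) *v w
      \<in> W" for js
    by (induction js)
      (simp_all add: assms mscale_mult_vector matrix_vector_mult_diff_rdistrib
        vec.subspace_scale vec.subspace_diff flip: matrix_vector_mul_assoc)
  then show ?thesis by (simp add: lagrange_idem_def del: upt_Suc)
qed

text \<open>Diagonalizability with all eigenvalues among the \<open>theta\<close> values, phrased by
  splitting vectors; components may be zero.\<close>

definition cube_spectral :: "'n::finite cmat \<Rightarrow> bool" where
  "cube_spectral X \<longleftrightarrow> (\<forall>w. \<exists>c. w = (\<Sum>k\<le>CARD('n). c k) \<and>
     (\<forall>k\<le>CARD('n). X *v c k = theta TYPE('n) k *s c k))"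

lemma lagrange_idem_component:
  fixes X :: "'n::finite cmat"
  assumes "\<And>k. k \<le> CARD('n) \<Longrightarrow> X *v c k = theta TYPE('n) k *s c k" and "i \<le> CARD('n)"
  shows "lagrange_idem X i *v (\<Sum>k\<le>CARD('n). c k) = c i"
proof -
  have "lagrange_idem X i *v (\<Sum>k\<le>CARD('n). c k) = (\<Sum>k\<le>CARD('n). if i = k then c k else 0)"
    unfolding matrix_vector_mult_sum_right
    by (rule sum.cong) (auto simp: lagrange_idem_eigenvector assms)
  then show ?thesis using assms(2) by simp
qed

lemma cube_spectral_decomposition:
  fixes X :: "'n::finite cmat"
  assumes "cube_spectral X"
  shows "w = (\<Sum>k\<le>CARD('n). lagrange_idem X k *v w)"
    and "k \<le> CARD('n) \<Longrightarrow> X *v (lagrange_idem X k *v w) = theta TYPE('n) k *s (lagrange_idem X k *v w)"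
proof -
  obtain c where c: "w = (\<Sum>k\<le>CARD('n). c k)" "\<And>k. k \<le> CARD('n) \<Longrightarrow> X *v c k = theta TYPE('n) k *s c k"
    using assms unfolding cube_spectral_def by metis
  have L: "lagrange_idem X k *v w = c k" if "k \<le> CARD('n)" for k
    unfolding c(1) using c(2) that by (rule lagrange_idem_component)
  show "w = (\<Sum>k\<le>CARD('n). lagrange_idem X k *v w)"
    by (subst c(1)) (simp add: L)
  show "k \<le> CARD('n) \<Longrightarrow> X *v (lagrange_idem X k *v w) = theta TYPE('n) k *s (lagrange_idem X k *v w)"
    by (simp add: L c(2))
qed

text \<open>Since \<open>N ** Q = Q ** M\<close>, the matrix \<open>Q\<close> carries eigenvectors
  of \<open>M\<close> to eigenvectors of \<open>N\<close>. Thus only the diagonal matrix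
  \<open>dualA\<close> needs a direct spectral decomposition.\<close>

lemma cube_spectral_similar:
  fixes M N P Q :: "'n::finite cmat"
  assumes "cube_spectral M" and "M ** P = P ** N" and "Q ** P = mat 1" and "P ** Q = mat 1"
  shows "cube_spectral N" and "i \<le> CARD('n) \<Longrightarrow> lagrange_idem N i = Q ** lagrange_idem M i ** P"
proof -
  have NQ: "N *v (Q *v w) = Q *v (M *v w)" for w
  proof -
    have "N ** Q = Q ** (P ** N) ** Q"
      by (simp add: matrix_mul_assoc assms(3))
    also have "\<dots> = Q ** M ** (P ** Q)"
      by (simp only: assms(2)[symmetric] matrix_mul_assoc)
    finally show ?thesis by (simp add: assms(4) matrix_vector_mul_assoc)
  qed
  have QP: "Q *v (P *v w) = w" for w
    by (simp add: matrix_vector_mul_assoc assms(3))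
  define c where "c w k = Q *v (lagrange_idem M k *v (P *v w))" for w k
  have c1: "w = (\<Sum>k\<le>CARD('n). c w k)" for w
    unfolding c_def
    by (simp add: cube_spectral_decomposition(1)[OF assms(1), symmetric] QP flip: matrix_vector_mult_sum_right)
  have c2: "N *v c w k = theta TYPE('n) k *s c w k" if "k \<le> CARD('n)" for w k
    unfolding c_def
    by (simp add: NQ cube_spectral_decomposition(2)[OF assms(1) that] vector_scalar_commute)
  show "cube_spectral N"
    unfolding cube_spectral_def using c1 c2 by metis
  have "lagrange_idem N i *v w = c w i" if "i \<le> CARD('n)" for w
    by (subst c1) (rule lagrange_idem_component[OF c2 that])
  then show "i \<le> CARD('n) \<Longrightarrow> lagrange_idem N i = Q ** lagrange_idem M i ** P"
    by (simp add: matrix_eq c_def flip: matrix_vector_mul_assoc)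
qed

definition hermitian_mat :: "'n::finite cmat \<Rightarrow> bool" where
  "hermitian_mat X \<longleftrightarrow> (\<forall>v w. herm (X *v v) w = herm v (X *v w))"

text \<open>Eigenspaces of a Hermitian matrix for distinct real eigenvalues are orthogonal, so on
  both sides only the pairing of the two \<open>i\<close>-th components survives.\<close>

lemma lagrange_idem_hermitian:
  fixes X :: "'n::finite cmat"
  assumes "cube_spectral X" and "hermitian_mat X" and "i \<le> CARD('n)"
  shows "herm (lagrange_idem X i *v v) w = herm v (lagrange_idem X i *v w)"
proof -
  let ?L = "lagrange_idem X"
  have orth: "herm (?L k *v v) (?L l *v w) = 0" if "k \<noteq> l" "k \<le> CARD('n)" "l \<le> CARD('n)" for k l
  proof -
    have "theta TYPE('n) k * herm (?L k *v v) (?L l *v w) = herm (X *v (?L k *v v)) (?L l *v w)"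
      by (simp only: cube_spectral_decomposition(2)[OF assms(1) that(2)] herm_scale_left)
    also have "\<dots> = herm (?L k *v v) (X *v (?L l *v w))"
      using assms(2) by (simp only: hermitian_mat_def)
    also have "\<dots> = theta TYPE('n) l * herm (?L k *v v) (?L l *v w)"
      by (simp only: cube_spectral_decomposition(2)[OF assms(1) that(3)] herm_scale_right cnj_theta)
    finally show ?thesis using that(1) by simp
  qed
  have "herm (?L i *v v) w = (\<Sum>k\<le>CARD('n). herm (?L i *v v) (?L k *v w))"
    by (subst cube_spectral_decomposition(1)[OF assms(1), of w]) (simp add: herm_sum_right)
  also have "\<dots> = (\<Sum>k\<in>{i}. herm (?L i *v v) (?L k *v w))"
    by (rule sum.mono_neutral_right) (use orth assms(3) in auto)
  also have "\<dots> = (\<Sum>k\<le>CARD('n). herm (?L k *v v) (?L i *v w))"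
    by (rule sum.mono_neutral_cong_left) (use orth assms(3) in auto)
  also have "\<dots> = herm v (?L i *v w)"
    by (subst (2) cube_spectral_decomposition(1)[OF assms(1), of v]) (simp add: herm_sum_left)
  finally show ?thesis .
qed

section \<open>Triples with cyclic commutation relations\<close>

text \<open>The relations are invariant under cyclic permutation. The spectral decomposition is
  asked of \<open>X\<close> alone: its idempotents are moved across the form, while those of
  \<open>Y\<close> act on explicit eigenvectors.\<close>

locale cube_triple =
  fixes X Y Z :: "'n::finite cmat"
  assumes comm_YX: "Y ** X - X ** Y = mscale (2 * \<i>) Z"
    and comm_XZ: "X ** Z - Z ** X = mscale (2 * \<i>) Y"
    and comm_ZY: "Z ** Y - Y ** Z = mscale (2 * \<i>) X"
    and herm_X: "hermitian_mat X" and herm_Y: "hermitian_mat Y" and herm_Z: "hermitian_mat Z"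
    and spectral_X: "cube_spectral X"
begin

section \<open>Ladder operators and the Casimir operator\<close>

definition raise :: "'n cvec \<Rightarrow> 'n cvec" where
  "raise w = (1 / 2) *s (Y *v w - \<i> *s (Z *v w))"

definition lower :: "'n cvec \<Rightarrow> 'n cvec" where
  "lower w = (1 / 2) *s (Y *v w + \<i> *s (Z *v w))"

definition casimir :: "'n cvec \<Rightarrow> 'n cvec" where
  "casimir w = X *v (X *v w) + Y *v (Y *v w) + Z *v (Z *v w)"

lemma swap_YX: "Y *v (X *v w) = X *v (Y *v w) + (2 * \<i>) *s (Z *v w)"
  using arg_cong[OF comm_YX, of "\<lambda>M. M *v w"]
  by (simp add: matrix_vector_mult_diff_rdistrib mscale_mult_vector algebra_simps
      flip: matrix_vector_mul_assoc)

lemma swap_XZ: "X *v (Z *v w) = Z *v (X *v w) + (2 * \<i>) *s (Y *v w)"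
  using arg_cong[OF comm_XZ, of "\<lambda>M. M *v w"]
  by (simp add: matrix_vector_mult_diff_rdistrib mscale_mult_vector algebra_simps
      flip: matrix_vector_mul_assoc)

lemma swap_ZY: "Z *v (Y *v w) = Y *v (Z *v w) + (2 * \<i>) *s (X *v w)"
  using arg_cong[OF comm_ZY, of "\<lambda>M. M *v w"]
  by (simp add: matrix_vector_mult_diff_rdistrib mscale_mult_vector algebra_simps
      flip: matrix_vector_mul_assoc)

lemma herm_swap: "herm (X *v v) w = herm v (X *v w)" "herm (Y *v v) w = herm v (Y *v w)"
    "herm (Z *v v) w = herm v (Z *v w)"
  using herm_X herm_Y herm_Z by (simp_all add: hermitian_mat_def)

lemma X_raise: "X *v raise w = raise (X *v w) + 2 *s raise w"
  unfolding raise_def mv_linear swap_YX swap_XZ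
  by (simp add: vec_eq_iff algebra_simps)

lemma X_lower: "X *v lower w = lower (X *v w) - 2 *s lower w"
  unfolding lower_def mv_linear swap_YX swap_XZ
  by (simp add: vec_eq_iff algebra_simps)

lemma raise_lower: "raise (lower w) = lower (raise w) + X *v w"
  unfolding lower_def raise_def mv_linear swap_ZY
  by (simp add: vec_eq_iff algebra_simps)

lemma Y_eq: "Y *v w = raise w + lower w"
  unfolding lower_def raise_def by (simp add: vec_eq_iff algebra_simps)

lemma raise_scale: "raise (c *s w) = c *s raise w"
  and lower_scale: "lower (c *s w) = c *s lower w"
  and raise_zero [simp]: "raise 0 = 0"
  and lower_zero [simp]: "lower 0 = 0"
  unfolding lower_def raise_def mv_linear by (simp_all add: vec_eq_iff algebra_simps)

text \<open>Conjugation in the second argument exchanges \<open>- \<i>\<close> and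
  \<open>\<i>\<close>, so the two ladder operators are adjoint.\<close>

lemma herm_raise: "herm (raise v) w = herm v (lower w)"
  unfolding lower_def raise_def by (simp add: herm_linear herm_swap)

lemma herm_lower: "herm (lower v) w = herm v (raise w)"
  unfolding lower_def raise_def by (simp add: herm_linear herm_swap)

text \<open>The product of the two ladder operators is a quarter of
  \<open>Y\<^sup>2 + Z\<^sup>2\<close> up to the commutator of \<open>Y\<close> and
  \<open>Z\<close>, which is a multiple of \<open>X\<close>.\<close>

lemma casimir_eq: "casimir w = X *v (X *v w) + 2 *s (X *v w) + 4 *s lower (raise w)"
  unfolding casimir_def lower_def raise_def mv_linear swap_ZY
  by (simp add: vec_eq_iff algebra_simps)

lemma casimir_eq': "casimir w = X *v (X *v w) - 2 *s (X *v w) + 4 *s raise (lower w)"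
  unfolding casimir_eq raise_lower by (simp add: vec_eq_iff algebra_simps)

text \<open>\<open>X\<close> and \<open>Y\<close> suffice: in the triple \<open>dualA\<close>,
  \<open>adjA\<close>, \<open>epsA\<close> they are the generators of the algebra.\<close>

lemma casimir_commute:
  "casimir (X *v w) = X *v casimir w" "casimir (Y *v w) = Y *v casimir w"
  unfolding casimir_def mv_linear swap_YX swap_XZ swap_ZY
  by (simp_all add: vec_eq_iff algebra_simps)

lemma casimir_eigenspace_subspace:
  assumes "vec.subspace W"
  shows "vec.subspace {w \<in> W. casimir w = c *s w}"
proof -
  have "casimir (v + w) = casimir v + casimir w" "casimir (a *s w) = a *s casimir w" for v w a
    unfolding casimir_def mv_linear by (simp_all add: vec_eq_iff algebra_simps)
  moreover have "casimir 0 = 0"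
    by (simp add: casimir_def)
  ultimately show ?thesis
    using assms unfolding vec.subspace_def by (simp add: vec_eq_iff algebra_simps)
qed

lemma casimir_highest:
  assumes "raise v = 0" and "X *v v = m *s v"
  shows "casimir v = (m * (m + 2)) *s v"
  unfolding casimir_eq assms mv_linear by (simp add: vec_eq_iff algebra_simps)

text \<open>Converse of \<open>casimir_highest\<close> by positivity: \<open>casimir_eq\<close>
  forces \<open>lower (raise v) = 0\<close>, and pairing with \<open>v\<close> gives the squared
  norm of \<open>raise v\<close>.\<close>

lemma raise_eq_zero:
  assumes "casimir v = (m * (m + 2)) *s v" and "X *v v = m *s v"
  shows "raise v = 0"
proof -
  have "4 *s lower (raise v) = 0"
    using assms unfolding casimir_eq by (simp add: mv_linear vec_eq_iff algebra_simps)
  then have "herm (lower (raise v)) v = 0"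
    by simp
  then show ?thesis
    by (simp add: herm_lower herm_self)
qed

text \<open>Pairing \<open>casimir_eq'\<close> with \<open>w\<close> leaves the nonnegative term \<open>4 |lower w|\<^sup>2\<close>.\<close>

lemma casimir_lower_bound:
  fixes \<mu> :: int and d :: nat
  assumes "casimir w = (of_nat d * (of_nat d + 2)) *s w" and "X *v w = of_int \<mu> *s w" and "w \<noteq> 0"
  shows "- int d \<le> \<mu>"
proof -
  have "4 * herm (raise (lower w)) w = (of_nat d * (of_nat d + 2) - of_int \<mu> * (of_int \<mu> - 2)) * herm w w"
    using arg_cong[OF assms(1), of "\<lambda>z. herm z w"] unfolding casimir_eq' assms(2) mv_linear
    by (simp add: herm_linear algebra_simps)
  then have "4 * complex_of_real ((norm (lower w))\<^sup>2)
      = (of_nat d * (of_nat d + 2) - of_int \<mu> * (of_int \<mu> - 2)) * complex_of_real ((norm w)\<^sup>2)"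
    by (simp only: herm_raise herm_self)
  also have "\<dots> = complex_of_real ((real d * (real d + 2) - of_int \<mu> * (of_int \<mu> - 2)) * (norm w)\<^sup>2)"
    by simp
  finally have "4 * (norm (lower w))\<^sup>2 = (real d * (real d + 2) - of_int \<mu> * (of_int \<mu> - 2)) * (norm w)\<^sup>2"
    by (metis (mono_tags, lifting) of_real_eq_iff of_real_mult of_real_numeral)
  moreover have "(norm w)\<^sup>2 > 0" "4 * (norm (lower w))\<^sup>2 \<ge> 0"
    using assms(3) by simp_all
  ultimately have "real d * (real d + 2) - of_int \<mu> * (of_int \<mu> - 2) \<ge> 0"
    by (metis zero_le_mult_iff less_le_not_le)
  then have "real_of_int (\<mu> * (\<mu> - 2)) \<le> real_of_int (int d * (int d + 2))"
    by simp
  then have le: "\<mu> * (\<mu> - 2) \<le> int d * (int d + 2)"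
    by (simp only: of_int_le_iff)
  show ?thesis
  proof (rule ccontr)
    assume "\<not> ?thesis"
    then have "int d < - \<mu>" by simp
    \<comment> \<open>The function \<open>t * (t + 2)\<close> is strictly increasing for nonnegative
      \<open>t\<close>.\<close>
    then have "int d * (int d + 2) < (- \<mu>) * (- \<mu> + 2)"
      by (intro mult_strict_mono) auto
    with le show False by (simp add: algebra_simps)
  qed
qed

section \<open>Strings of divided powers below a highest weight vector\<close>

definition string :: "'n cvec \<Rightarrow> nat \<Rightarrow> 'n cvec" where
  "string v j = (1 / fact j) *s (lower ^^ j) v"

lemma string_0 [simp]: "string v 0 = v"
  by (simp add: string_def)

lemma lower_string: "lower (string v j) = of_nat (Suc j) *s string v (Suc j)"
  by (simp add: string_def lower_scale vector_smult_assoc del: of_nat_Suc)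

lemma X_string:
  assumes "X *v v = m *s v"
  shows "X *v string v j = (m - 2 * of_nat j) *s string v j"
proof (induction j)
  case (Suc j)
  have "X *v lower (string v j) = (m - 2 * of_nat (Suc j)) *s lower (string v j)"
    unfolding X_lower Suc lower_scale by (simp add: vec_eq_iff algebra_simps)
  then have "of_nat (Suc j) *s (X *v string v (Suc j))
      = of_nat (Suc j) *s ((m - 2 * of_nat (Suc j)) *s string v (Suc j))"
    unfolding lower_string vector_scalar_commute by (simp only: vector_smult_assoc mult.commute)
  then show ?case
    by (metis vec.scale_cancel_left of_nat_neq_0)
qed (simp add: assms)

text \<open>Commuting \<open>raise\<close> past one \<open>lower\<close> costs a copy of
  \<open>X\<close>, whose value \<open>X_string\<close> supplies. With divided powers the
  coefficient is just \<open>m - j\<close>.\<close>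

lemma raise_string:
  assumes "X *v v = m *s v" and "raise v = 0"
  shows "raise (string v (Suc j)) = (m - of_nat j) *s string v j"
proof (induction j)
  case 0
  have "lower v = string v (Suc 0)"
    using lower_string[of v 0] by simp
  then have "raise (string v (Suc 0)) = raise (lower v)"
    by simp
  then show ?case
    by (simp add: raise_lower assms)
next
  case (Suc j)
  have "of_nat (Suc (Suc j)) *s raise (string v (Suc (Suc j))) = raise (lower (string v (Suc j)))"
    by (simp only: lower_string raise_scale)
  also have "\<dots> = lower (raise (string v (Suc j))) + X *v string v (Suc j)"
    by (rule raise_lower)
  also have "\<dots> = of_nat (Suc (Suc j)) *s ((m - of_nat (Suc j)) *s string v (Suc j))"
    unfolding Suc lower_scale lower_string X_string[OF assms(1)]
    by (simp add: vec_eq_iff algebra_simps)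
  finally show ?case
    by (metis vec.scale_cancel_left of_nat_neq_0)
qed

text \<open>One \<open>lower\<close> is moved across the form and evaluated by
  \<open>raise_string\<close>. The ratio of consecutive norms shows that \<open>m\<close> is
  nonnegative and that a string of weight \<open>d\<close> is nonzero exactly up to index
  \<open>d\<close>.\<close>

lemma string_norm:
  assumes "X *v v = of_int m *s v" and "raise v = 0"
  shows "real (Suc j) * (norm (string v (Suc j)))\<^sup>2 = (of_int m - real j) * (norm (string v j))\<^sup>2"
proof -
  have "of_nat (Suc j) * herm (string v (Suc j)) (string v (Suc j))
      = herm (lower (string v j)) (string v (Suc j))"
    by (simp only: lower_string herm_scale_left)
  also have "\<dots> = cnj (of_int m - of_nat j) * herm (string v j) (string v j)"
    by (simp only: herm_lower raise_string[OF assms] herm_scale_right)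
  also have "\<dots> = complex_of_real ((of_int m - real j) * (norm (string v j))\<^sup>2)"
    by (simp add: herm_self)
  also have "of_nat (Suc j) * herm (string v (Suc j)) (string v (Suc j))
      = complex_of_real (real (Suc j) * (norm (string v (Suc j)))\<^sup>2)"
    by (simp add: herm_self)
  finally show ?thesis
    by (simp only: of_real_eq_iff)
qed

lemma highest_weight_nonneg:
  assumes "X *v v = of_int m *s v" and "raise v = 0" and "v \<noteq> 0"
  shows "m \<ge> 0"
proof -
  have "of_int m * (norm v)\<^sup>2 = (norm (string v (Suc 0)))\<^sup>2"
    using string_norm[OF assms(1,2), of 0] by simp
  then have "of_int m * (norm v)\<^sup>2 \<ge> 0"
    by simp
  then show ?thesis
    using assms(3) by (simp add: zero_le_mult_iff)
qed

lemma string_Suc_eq_zero: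
  assumes "X *v v = of_nat d *s v" and "raise v = 0"
  shows "string v (Suc d) = 0"
  using string_norm[of v "int d" d] assms by simp

lemma string_nonzero:
  assumes "X *v v = of_nat d *s v" and "raise v = 0" and "v \<noteq> 0" and "j \<le> d"
  shows "string v j \<noteq> 0"
  using assms(4)
proof (induction j)
  case (Suc j)
  then have "(real d - real j) * (norm (string v j))\<^sup>2 > 0"
    by simp
  then show ?case
    using string_norm[of v "int d" j] assms(1,2) by auto
qed (simp add: assms)

text \<open>Write \<open>lower\<close> as \<open>Y\<close> minus \<open>raise\<close>. Moving
  \<open>Y\<close> onto \<open>u\<close> gives the factor \<open>d\<close>, and \<open>raise\<close>
  returns to the previous pairing; after binomial absorption this is the recursion of the binomial
  coefficients.\<close>

lemma herm_string:
  assumes "X *v v = of_nat d *s v" and "raise v = 0" and "Y *v u = of_nat d *s u" and "j \<le> d"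
  shows "herm (string v j) u = of_nat (d choose j) * herm v u"
  using assms(4)
proof (induction j rule: less_induct)
  case (less j)
  show ?case
  proof (cases j)
    case (Suc l)
    have l: "herm (string v l) u = of_nat (d choose l) * herm v u"
      using less Suc by simp
    have r: "herm (raise (string v l)) u = of_nat l * of_nat (d choose l) * herm v u"
    proof (cases l)
      case (Suc k)
      have IH: "herm (string v k) u = of_nat (d choose k) * herm v u"
        using less \<open>j = Suc l\<close> Suc by simp
      have "herm (raise (string v l)) u = (of_nat d - of_nat k) * of_nat (d choose k) * herm v u"
        unfolding Suc by (simp only: raise_string[OF assms(1,2)] herm_scale_left IH) simp
      also have "(of_nat d - of_nat k) * of_nat (d choose k) = of_nat l * (of_nat (d choose l) :: complex)"
        using of_nat_binomial_Suc[of k d] Suc by simp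
      finally show ?thesis .
    qed (simp add: assms)
    have "of_nat (Suc l) * herm (string v (Suc l)) u = herm (Y *v string v l - raise (string v l)) u"
      by (simp add: Y_eq lower_string herm_scale_left del: of_nat_Suc)
    also have "\<dots> = herm (string v l) (Y *v u) - herm (raise (string v l)) u"
      by (simp add: herm_diff_left herm_swap)
    also have "\<dots> = (of_nat d - of_nat l) * of_nat (d choose l) * herm v u"
      by (simp add: assms(3) herm_scale_right l r algebra_simps)
    also have "\<dots> = of_nat (Suc l) * (of_nat (d choose Suc l) * herm v u)"
      using of_nat_binomial_Suc[of l d] by (simp only: mult.assoc[symmetric])
    finally show ?thesis
      by (simp add: Suc del: of_nat_Suc)
  qed simp
qed

section \<open>Eigenvectors of \<open>Y\<close> with Krawtchouk polynomials (parameter 1/2) as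
  coefficients\<close>

definition krawtchouk_vector :: "nat \<Rightarrow> 'n cvec \<Rightarrow> nat \<Rightarrow> 'n cvec" where
  "krawtchouk_vector d v i = (\<Sum>j\<le>d. hyp2F1 d i j *s string v j)"

text \<open>\<open>Y\<close> is the sum of the ladder operators, so \<open>string v j\<close>
  receives contributions from its two neighbours; \<open>hyp2F1_recurrence\<close> combines
  them.\<close>

lemma Y_krawtchouk_vector:
  assumes "X *v v = of_nat d *s v" and "raise v = 0" and "i \<le> d"
  shows "Y *v krawtchouk_vector d v i = (of_nat d - 2 * of_nat i) *s krawtchouk_vector d v i"
proof -
  let ?F = "hyp2F1 d i" and ?s = "string v"
  have lower: "(\<Sum>j\<le>d. ?F j *s lower (?s j)) = (\<Sum>j\<le>d. (of_nat j * ?F (j - 1)) *s ?s j)"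
  proof -
    have "(\<Sum>j\<le>d. ?F j *s lower (?s j)) = (\<Sum>j\<le>d. (of_nat (Suc j) * ?F (Suc j - 1)) *s ?s (Suc j))"
      by (simp add: lower_string vector_smult_assoc mult.commute del: of_nat_Suc)
    also have "\<dots> = (\<Sum>j\<le>Suc d. (of_nat j * ?F (j - 1)) *s ?s j)"
      by (simp add: sum.atMost_Suc_shift del: sum.atMost_Suc of_nat_Suc)
    also have "\<dots> = (\<Sum>j\<le>d. (of_nat j * ?F (j - 1)) *s ?s j)"
      by (simp add: string_Suc_eq_zero[OF assms(1,2)])
    finally show ?thesis .
  qed
  have raise: "(\<Sum>j\<le>d. ?F j *s raise (?s j)) = (\<Sum>j\<le>d. ((of_nat d - of_nat j) * ?F (Suc j)) *s ?s j)"
  proof -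
    \<comment> \<open>Both ends of the shift are free: the added term is 0 because the string stops
      at \<open>d\<close>, and the dropped one because \<open>raise v = 0\<close>.\<close>
    have "(\<Sum>j\<le>d. ?F j *s raise (?s j)) = (\<Sum>j\<le>Suc d. ?F j *s raise (?s j))"
      by (simp add: string_Suc_eq_zero[OF assms(1,2)])
    also have "\<dots> = (\<Sum>j\<le>d. ?F (Suc j) *s raise (?s (Suc j)))"
      by (subst sum.atMost_Suc_shift) (simp add: assms(2))
    finally show ?thesis
      by (simp only: raise_string[OF assms(1,2)] vector_smult_assoc mult.commute)
  qed
  have "Y *v krawtchouk_vector d v i = (\<Sum>j\<le>d. ?F j *s lower (?s j)) + (\<Sum>j\<le>d. ?F j *s raise (?s j))"
    unfolding krawtchouk_vector_def matrix_vector_mult_sum_right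
    by (simp add: vector_scalar_commute Y_eq vector_add_ldistrib sum.distrib)
  also have "\<dots> = (\<Sum>j\<le>d. (of_nat j * ?F (j - 1) + (of_nat d - of_nat j) * ?F (Suc j)) *s ?s j)"
    by (simp add: lower raise vector_sadd_rdistrib sum.distrib)
  also have "\<dots> = (\<Sum>j\<le>d. ((of_nat d - 2 * of_nat i) * ?F j) *s ?s j)"
    by (rule sum.cong) (simp_all only: atMost_iff hyp2F1_recurrence[OF assms(3)])
  finally show ?thesis
    by (simp add: krawtchouk_vector_def vec.scale_sum_right vector_smult_assoc)
qed

text \<open>Exchanging the sums makes the coefficient of \<open>string v j\<close> the binomial sum
  of \<open>hyp2F1_binomial_sum\<close>, which leaves only \<open>j = 0\<close>.\<close>

lemma highest_eq_sum_krawtchouk: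
  "v = (\<Sum>i\<le>d. (of_nat (d choose i) / 2 ^ d) *s krawtchouk_vector d v i)"
proof -
  have "(\<Sum>i\<le>d. (of_nat (d choose i) / 2 ^ d) *s krawtchouk_vector d v i)
      = (\<Sum>j\<le>d. \<Sum>i\<le>d. (of_nat (d choose i) / 2 ^ d * hyp2F1 d i j) *s string v j)"
    unfolding krawtchouk_vector_def vec.scale_sum_right vector_smult_assoc
    by (rule sum.swap)
  also have "\<dots> = (\<Sum>j\<le>d. ((\<Sum>i\<le>d. of_nat (d choose i) * hyp2F1 d i j) / 2 ^ d) *s string v j)"
    by (simp add: vec.scale_sum_left sum_divide_distrib)
  also have "\<dots> = (\<Sum>j\<le>d. if j = 0 then string v j else 0)"
    by (rule sum.cong) (auto simp: hyp2F1_binomial_sum)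
  finally show ?thesis by simp
qed

text \<open>As \<open>CARD('n) = d + 2 * r\<close>, the \<open>k\<close>-th Krawtchouk vector has
  eigenvalue \<open>theta\<close> of \<open>r + k\<close>, so the idempotent selects one summand of
  the expansion of \<open>v\<close>.\<close>

lemma lagrange_idem_highest:
  assumes "X *v v = of_nat d *s v" and "raise v = 0" and "CARD('n) = d + 2 * r" and "i \<le> d"
  shows "lagrange_idem Y (r + i) *v v = (of_nat (d choose i) / 2 ^ d) *s krawtchouk_vector d v i"
proof -
  have "lagrange_idem Y (r + i) *v krawtchouk_vector d v k = (if i = k then krawtchouk_vector d v k else 0)"
    if "k \<le> d" for k
    using lagrange_idem_eigenvector[of Y "krawtchouk_vector d v k" "r + k" "r + i"]
      Y_krawtchouk_vector[OF assms(1,2) that] that assms(3)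
    by (simp add: theta_def)
  then have "lagrange_idem Y (r + i) *v (\<Sum>k\<le>d. (of_nat (d choose k) / 2 ^ d) *s krawtchouk_vector d v k)
    = (\<Sum>k\<le>d. if i = k then (of_nat (d choose k) / 2 ^ d) *s krawtchouk_vector d v k else 0)"
    unfolding matrix_vector_mult_sum_right vector_scalar_commute
    by (intro sum.cong) auto
  then show ?thesis
    using assms(4) by (simp flip: highest_eq_sum_krawtchouk)
qed

text \<open>All three parts of the theorem in one. The idempotent of \<open>X\<close> is moved to
  the left, where it selects the \<open>j\<close>-th string vector in the \<open>i\<close>-th
  Krawtchouk vector; \<open>herm_string\<close> evaluates what remains.\<close>

lemma herm_lagrange_idem:
  assumes "X *v v = of_nat d *s v" and "raise v = 0" and "Y *v u = of_nat d *s u"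
    and "CARD('n) = d + 2 * r" and "i \<le> d" and "j \<le> d"
  shows "herm (lagrange_idem Y (r + i) *v v) (lagrange_idem X (r + j) *v u)
    = 1 / 2 ^ d * herm v u * of_nat (d choose i) * of_nat (d choose j) * hyp2F1 d i j"
proof -
  have L: "lagrange_idem X (r + j) *v string v k = (if j = k then string v k else 0)" if "k \<le> d" for k
    using lagrange_idem_eigenvector[of X "string v k" "r + k" "r + j"] X_string[OF assms(1)] that assms(4)
    by (simp add: theta_def)
  have "herm (lagrange_idem Y (r + i) *v v) (lagrange_idem X (r + j) *v u)
    = herm (lagrange_idem X (r + j) *v (lagrange_idem Y (r + i) *v v)) u"
    by (rule lagrange_idem_hermitian[OF spectral_X herm_X, symmetric]) (use assms(4,6) in simp)
  also have "\<dots> = of_nat (d choose i) / 2 ^ d * herm (lagrange_idem X (r + j) *v krawtchouk_vector d v i) u"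
    by (simp only: lagrange_idem_highest[OF assms(1,2,4,5)] vector_scalar_commute herm_scale_left)
  also have "lagrange_idem X (r + j) *v krawtchouk_vector d v i
    = (\<Sum>k\<le>d. if j = k then hyp2F1 d i k *s string v k else 0)"
    unfolding krawtchouk_vector_def matrix_vector_mult_sum_right vector_scalar_commute
    by (rule sum.cong) (simp_all add: L)
  also have "\<dots> = hyp2F1 d i j *s string v j"
    using assms(6) by simp
  finally show ?thesis
    using assms(6) by (simp add: herm_scale_left herm_string[OF assms(1-3)])
qed

end

section \<open>The three matrices of the cube\<close>

definition flip :: "'n::finite vertex \<Rightarrow> 'n \<Rightarrow> 'n vertex" where
  "flip y k = (\<chi> l. if l = k then \<not> y $ l else y $ l)"

lemma flip_nth: "flip y k $ l = (if l = k then \<not> y $ l else y $ l)"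
  by (simp add: flip_def)

lemma flip_flip [simp]: "flip (flip y k) k = y"
  by (simp add: vec_eq_iff flip_nth)

lemma inj_flip: "inj (flip y)"
proof (rule injI)
  fix k l assume "flip y k = flip y l"
  then have "flip y k $ k = flip y l $ k" by simp
  then show "k = l" by (auto simp: flip_nth split: if_splits)
qed

lemma cube_adj_iff_flip: "cube_adj y z \<longleftrightarrow> (\<exists>k. z = flip y k)"
proof
  assume "cube_adj y z"
  then obtain k where k: "{l. y $ l \<noteq> z $ l} = {k}"
    unfolding cube_adj_def by (auto simp: card_1_singleton_iff)
  have "z $ l = flip y k $ l" for l
    using k by (cases "l = k") (auto simp: flip_nth)
  then show "\<exists>k. z = flip y k" by (auto simp: vec_eq_iff)
next
  assume "\<exists>k. z = flip y k"
  then obtain k where "z = flip y k" by blast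
  then have "{l. y $ l \<noteq> z $ l} = {k}" by (auto simp: flip_nth)
  then show "cube_adj y z" by (simp add: cube_adj_def)
qed

lemma cube_adj_sym: "cube_adj y z \<longleftrightarrow> cube_adj z y"
  by (simp add: cube_adj_def eq_commute)

text \<open>Turns products with matrices supported on edges into sums over coordinates.\<close>

lemma sum_cube_adj:
  fixes g :: "'n::finite vertex \<Rightarrow> complex"
  shows "(\<Sum>w\<in>UNIV. (if cube_adj y w then h w else 0) * g w) = (\<Sum>k\<in>UNIV. h (flip y k) * g (flip y k))"
proof -
  have "(\<Sum>w\<in>UNIV. (if cube_adj y w then h w else 0) * g w) = (\<Sum>w\<in>range (flip y). h w * g w)"
    by (rule sum.mono_neutral_cong_right) (auto simp: cube_adj_iff_flip)
  then show ?thesis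
    by (simp add: sum.reindex[OF inj_flip])
qed

definition ones :: "'n::finite vertex \<Rightarrow> nat" where
  "ones y = card {k. y $ k}"

lemma ones_flip: "int (ones (flip y k)) = int (ones y) + (if y $ k then - 1 else 1)"
proof (cases "y $ k")
  case True
  then have "{l. y $ l} = insert k {l. flip y k $ l}" by (auto simp: flip_nth)
  moreover have "k \<notin> {l. flip y k $ l}" using True by (simp add: flip_nth)
  ultimately show ?thesis using True by (simp add: ones_def)
next
  case False
  then have "{l. flip y k $ l} = insert k {l. y $ l}" by (auto simp: flip_nth)
  then show ?thesis using False by (simp add: ones_def)
qed

lemma ones_le: "ones (y :: 'n::finite vertex) \<le> CARD('n)"
  by (simp add: ones_def card_mono)

lemma relpowp_cube_adj_ones: "(cube_adj ^^ n) base_vertex y \<Longrightarrow> ones y \<le> n"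
proof (induction n arbitrary: y)
  case 0
  then show ?case by (auto simp: ones_def base_vertex_def)
next
  case (Suc n)
  then obtain z where "(cube_adj ^^ n) base_vertex z" "cube_adj z y" by auto
  then have "ones z \<le> n" and "\<exists>k. y = flip z k"
    using Suc.IH by (simp_all flip: cube_adj_iff_flip)
  then obtain k where "y = flip z k" by blast
  then show ?case using \<open>ones z \<le> n\<close> ones_flip[of z k] by (simp split: if_splits)
qed

lemma relpowp_cube_adj_base: "(cube_adj ^^ ones y) base_vertex y"
proof (induction "ones y" arbitrary: y)
  case 0
  then have "y = base_vertex" by (simp add: ones_def base_vertex_def vec_eq_iff)
  then show ?case by (simp add: ones_def base_vertex_def)
next
  case (Suc n)
  then obtain k where k: "y $ k"
    by (metis (mono_tags, lifting) card.empty empty_Collect_eq ones_def nat.distinct(1))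
  then have n: "n = ones (flip y k)" using ones_flip[of y k] Suc(2) by simp
  then have "(cube_adj ^^ n) base_vertex (flip y k)" using Suc(1) by blast
  moreover have "cube_adj (flip y k) y"
    unfolding cube_adj_iff_flip by (metis flip_flip)
  ultimately show ?case by (metis Suc(2) relpowp_Suc_I)
qed

text \<open>Each step of a walk raises the weight by at most one, and clearing the coordinates one
  at a time gives a walk of length \<open>ones y\<close>.\<close>

lemma cube_dist_base: "cube_dist base_vertex y = ones y"
  unfolding cube_dist_def
  by (rule Least_equality) (auto intro: relpowp_cube_adj_base relpowp_cube_adj_ones)

text \<open>The theorem mentions only the idempotents \<open>epsE\<close> of this matrix;
  \<open>lagrange_idem_epsA\<close> links the two.\<close>

definition epsA :: "'n::finite cmat" where
  "epsA = mscale (- \<i> / 2) (adjA ** dualA - dualA ** adjA)"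

lemma adjA_nth: "adjA $ y $ z = (if cube_adj y z then 1 else 0)"
  by (simp add: adjA_def)

lemma dualA_nth: "dualA $ y $ z = (if y = z then theta TYPE('n) (ones y) else 0)"
  for y :: "'n::finite vertex"
  by (simp add: dualA_def theta_def cube_dist_base)

lemma dualA_mult_nth: "(dualA ** M) $ y $ z = theta TYPE('n) (ones y) * M $ y $ z"
  and mult_dualA_nth: "(M ** dualA) $ y $ z = M $ y $ z * theta TYPE('n) (ones z)"
  for y z :: "'n::finite vertex"
  by (simp_all add: matrix_matrix_mult_def dualA_nth if_distrib[of "\<lambda>x. x * _"] if_distrib[of "(*) _"] cong: if_cong)

lemma dualA_mult_vector_nth: "(dualA *v w) $ y = theta TYPE('n) (ones y) * w $ y"
  for y :: "'n::finite vertex"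
  by (simp add: matrix_vector_mult_def dualA_nth if_distrib[of "\<lambda>x. x * _"] cong: if_cong)

lemma theta_ones_flip: "theta TYPE('n) (ones (flip y k)) = theta TYPE('n) (ones y) + (if y $ k then 2 else - 2)"
  for y :: "'n::finite vertex"
proof -
  have "of_int (int (ones (flip y k))) = (of_int (int (ones y) + (if y $ k then - 1 else 1)) :: complex)"
    by (simp only: ones_flip)
  then show ?thesis by (simp add: theta_def split: if_splits)
qed

text \<open>The \<open>theta\<close> values of adjacent vertices differ by 2, so the nonzero entries
  are \<open>\<i>\<close> and \<open>- \<i>\<close>.\<close>

lemma epsA_nth: "epsA $ y $ z = (if cube_adj y z then
    - \<i> / 2 * (theta TYPE('n) (ones z) - theta TYPE('n) (ones y)) else 0)"
  for y :: "'n::finite vertex"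
  by (simp add: epsA_def mscale_def dualA_mult_nth mult_dualA_nth adjA_nth algebra_simps)

lemma epsA_mult_nth: "(epsA ** M) $ y $ z = (\<Sum>k\<in>UNIV. (if y $ k then - \<i> else \<i>) * M $ flip y k $ z)"
  for y :: "'n::finite vertex"
  unfolding matrix_matrix_mult_def
  by (simp add: epsA_nth sum_cube_adj theta_ones_flip cong: if_cong)
     (rule sum.cong, auto)

lemma mult_epsA_nth: "(M ** epsA) $ y $ z = (\<Sum>k\<in>UNIV. (if z $ k then \<i> else - \<i>) * M $ y $ flip z k)"
  for z :: "'n::finite vertex"
  unfolding matrix_matrix_mult_def
  by (simp add: epsA_nth cube_adj_sym[of _ z] mult.commute[of "M $ _ $ _"] sum_cube_adj theta_ones_flip cong: if_cong)
     (rule sum.cong, auto)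

lemma adjA_mult_nth: "(adjA ** M) $ y $ z = (\<Sum>k\<in>UNIV. M $ flip y k $ z)"
  for y :: "'n::finite vertex"
  using sum_cube_adj[of y "\<lambda>_. 1" "\<lambda>w. M $ w $ z"]
  by (simp add: matrix_matrix_mult_def adjA_nth)

lemma mult_adjA_nth: "(M ** adjA) $ y $ z = (\<Sum>k\<in>UNIV. M $ y $ flip z k)"
  for z :: "'n::finite vertex"
  using sum_cube_adj[of z "\<lambda>_. 1" "\<lambda>w. M $ y $ w"]
  by (simp add: matrix_matrix_mult_def adjA_nth cube_adj_sym[of _ z] mult.commute)

section \<open>Conjugation by the Kronecker power\<close>

lemma matP_flip_left: "matP $ flip y k $ z = (if y $ k = z $ k then - \<i> else \<i>) * matP $ y $ z"
proof -
  \<comment> \<open>Splits off the only Kronecker factor that a flip at \<open>k\<close>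
    changes.\<close>
  have *: "matP $ x $ z = P1 $ (x $ k) $ (z $ k) * (\<Prod>l\<in>UNIV - {k}. P1 $ (x $ l) $ (z $ l))" for x
    by (simp add: matP_def prod.remove[of UNIV k])
  show ?thesis
    unfolding *[of y] *[of "flip y k"] by (simp add: flip_nth P1_def)
qed

lemma matP_flip_right: "matP $ y $ flip z k = (if y $ k then - 1 else 1) * matP $ y $ z"
proof -
  have *: "matP $ y $ x = P1 $ (y $ k) $ (x $ k) * (\<Prod>l\<in>UNIV - {k}. P1 $ (y $ l) $ (x $ l))" for x
    by (simp add: matP_def prod.remove[of UNIV k])
  show ?thesis
    unfolding *[of z] *[of "flip z k"] by (simp add: flip_nth P1_def)
qed

lemma theta_ones_eq_sum: "theta TYPE('n) (ones y) = (\<Sum>k\<in>UNIV. if y $ k then - 1 else 1)"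
  for y :: "'n::finite vertex"
proof -
  have "(\<Sum>k\<in>UNIV. if y $ k then - 1 else (1::complex)) = (\<Sum>k\<in>UNIV. 1 - 2 * (if y $ k then 1 else 0))"
    by (rule sum.cong) auto
  then show ?thesis
    by (simp add: sum_subtractf theta_def ones_def sum.If_cases flip: sum_distrib_left)
qed

text \<open>With the next two lemmas: conjugation by \<open>matP\<close> sends \<open>dualA\<close>
  to \<open>adjA\<close>, \<open>adjA\<close> to \<open>epsA\<close> and \<open>epsA\<close> to
  \<open>dualA\<close>. Each is checked coordinate by coordinate.\<close>

lemma dualA_matP: "dualA ** matP = matP ** adjA"
  by (simp add: vec_eq_iff dualA_mult_nth mult_adjA_nth matP_flip_right theta_ones_eq_sum sum_distrib_right)

lemma adjA_matP: "adjA ** matP = matP ** epsA"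
  unfolding vec_eq_iff adjA_mult_nth mult_epsA_nth matP_flip_left matP_flip_right
  by (auto intro!: sum.cong)

lemma epsA_matP: "epsA ** matP = matP ** dualA"
  unfolding vec_eq_iff epsA_mult_nth mult_dualA_nth matP_flip_left theta_ones_eq_sum sum_distrib_left
  by (auto intro!: sum.cong)

text \<open>The sum over vertices of a product over coordinates factors, which reduces the claim to
  the orthogonal rows of \<open>P1\<close>, of squared norm 2.\<close>

lemma matP_unitary:
  "(\<Sum>w\<in>UNIV. matP $ y $ w * cnj (matP $ z $ w)) = (if y = z then 2 ^ CARD('n) else 0)"
  for y z :: "'n::finite vertex"
proof -
  define g where "g k b = P1 $ (y $ k) $ b * cnj (P1 $ (z $ k) $ b)" for k b
  \<comment> \<open>Vertices are vectors, whereas the distributive law sums over functions.\<close>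
  have "bij_betw vec_lambda (UNIV :: ('n \<Rightarrow> bool) set) UNIV"
    by (metis bij_betw_def inj_def surj_def vec_lambda_inverse vec_nth_inverse UNIV_I vec_lambda_inject)
  then have "(\<Sum>w\<in>UNIV. \<Prod>k\<in>UNIV. g k (w $ k)) = (\<Sum>f\<in>UNIV. \<Prod>k\<in>UNIV. g k (f k))"
    by (subst sum.reindex_bij_betw[symmetric]) (auto simp: vec_lambda_inverse)
  also have "\<dots> = (\<Prod>k\<in>UNIV. \<Sum>b\<in>UNIV. g k b)"
    by (subst prod_sum_PiE) (auto simp: PiE_UNIV_domain)
  also have "\<dots> = (\<Prod>k\<in>UNIV. if y $ k = z $ k then 2 else 0)"
    by (rule prod.cong) (auto simp: g_def P1_def UNIV_bool)
  also have "\<dots> = (if y = z then 2 ^ CARD('n) else 0)"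
    by (auto simp: vec_eq_iff prod_zero_iff)
  finally show ?thesis
    by (simp add: g_def matP_def prod.distrib)
qed

lemma invertible_matP: "invertible (matP :: 'n::finite cmat)"
proof -
  define Q :: "'n cmat" where "Q = (\<chi> y z. cnj (matP $ z $ y) / 2 ^ CARD('n))"
  have "matP ** Q = mat 1"
    by (simp add: vec_eq_iff matrix_matrix_mult_def Q_def mat_def matP_unitary flip: sum_divide_distrib)
  then show ?thesis
    by (metis invertible_def matrix_left_right_inverse)
qed

lemma matP_inverse:
  "matrix_inv matP ** matP = (mat 1 :: 'n::finite cmat)"
  "matP ** matrix_inv matP = (mat 1 :: 'n cmat)"
  using someI_ex[OF invertible_matP[where 'n = 'n, unfolded invertible_def]] by (simp_all add: matrix_inv_def)

lemma matP_cancel: "matP ** M = matP ** N \<Longrightarrow> M = N"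
  by (metis matP_inverse(1) matrix_mul_assoc matrix_mul_lid)

section \<open>Spectral decompositions and idempotents of the three matrices\<close>

lemma dualE_nth: "(dualE i *v w) $ y = (if ones y = i then w $ y else 0)"
proof -
  have "(dualE i *v w) $ y = (\<Sum>z\<in>UNIV. if y = z then (if ones y = i then w $ y else 0) else 0)"
    unfolding dualE_def matrix_vector_mult_def cube_dist_base vec_lambda_beta by (rule sum.cong) auto
  then show ?thesis by simp
qed

lemma dualA_dualE: "dualA *v (dualE i *v w) = theta TYPE('n) i *s (dualE i *v (w :: 'n::finite cvec))"
  by (simp add: vec_eq_iff dualA_mult_vector_nth dualE_nth)

lemma sum_dualE: "(\<Sum>i\<le>CARD('n). dualE i *v w) = (w :: 'n::finite cvec)"
  by (simp add: vec_eq_iff dualE_nth ones_le)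

lemma cube_spectral_dualA: "cube_spectral (dualA :: 'n::finite cmat)"
  unfolding cube_spectral_def by (metis sum_dualE dualA_dualE)

lemma lagrange_idem_dualA:
  assumes "i \<le> CARD('n)"
  shows "lagrange_idem dualA i = (dualE i :: 'n::finite cmat)"
  unfolding matrix_eq
proof
  fix w :: "'n cvec"
  have "lagrange_idem dualA i *v (\<Sum>k\<le>CARD('n). dualE k *v w) = dualE i *v w"
    by (rule lagrange_idem_component[OF dualA_dualE assms])
  then show "lagrange_idem dualA i *v w = dualE i *v w"
    by (simp only: sum_dualE)
qed

lemma lagrange_idem_adjA: "lagrange_idem adjA i = idE i"
  by (simp add: lagrange_idem_def idE_def)

lemmas spectral_similar = cube_spectral_similar[OF _ _ matP_inverse]

lemma cube_spectral_adjA: "cube_spectral adjA"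
  by (rule spectral_similar(1)[OF cube_spectral_dualA dualA_matP])

lemma cube_spectral_epsA: "cube_spectral epsA"
  by (rule spectral_similar(1)[OF cube_spectral_adjA adjA_matP])

lemma lagrange_idem_epsA: "i \<le> CARD('n) \<Longrightarrow> lagrange_idem epsA i = (epsE i :: 'n::finite cmat)"
  by (simp add: spectral_similar(2)[OF cube_spectral_adjA adjA_matP] epsE_def lagrange_idem_adjA)

lemma hermitian_matI:
  assumes "\<And>y z. cnj (X $ y $ z) = X $ z $ y"
  shows "hermitian_mat X"
  unfolding hermitian_mat_def herm_def matrix_vector_mult_def
  by (simp add: sum_distrib_left sum_distrib_right assms mult_ac) (subst sum.swap, simp)

lemma hermitian_adjA: "hermitian_mat adjA"
  by (rule hermitian_matI) (simp add: adjA_nth cube_adj_sym)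

lemma hermitian_dualA: "hermitian_mat dualA"
  by (rule hermitian_matI) (simp add: dualA_nth)

lemma hermitian_epsA: "hermitian_mat epsA"
  by (rule hermitian_matI) (auto simp: epsA_nth cube_adj_sym algebra_simps)

section \<open>Commutation relations and the three triples\<close>

lemma comm_A_dual: "adjA ** dualA - dualA ** adjA = mscale (2 * \<i>) epsA"
  by (simp add: epsA_def mscale_def vec_eq_iff)

lemma mscale_mult_left: "mscale c M ** N = mscale c (M ** N)"
  and mscale_mult_right: "M ** mscale c N = mscale c (M ** N)"
  by (simp_all add: mscale_def vec_eq_iff matrix_matrix_mult_def sum_distrib_left mult_ac)

lemma matrix_mult_diff_left: "(M - N) ** K = M ** K - N ** K"
  and matrix_mult_diff_right: "K ** (M - N) = K ** M - K ** N"
  for K M N :: "'n::finite cmat"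
  by (simp_all add: vec_eq_iff matrix_matrix_mult_def algebra_simps sum_subtractf)

text \<open>\<open>comm_A_dual\<close> holds by definition of \<open>epsA\<close>; the other two
  relations are obtained from it by repeated conjugation with \<open>matP\<close>.\<close>

lemma commutator_similar:
  fixes M :: "'n::finite cmat"
  assumes "M ** N - N ** M = mscale c K"
    and "M ** matP = matP ** M'" and "N ** matP = matP ** N'" and "K ** matP = matP ** K'"
  shows "M' ** N' - N' ** M' = mscale c K'"
proof (rule matP_cancel)
  have "matP ** (M' ** N' - N' ** M') = (M ** N - N ** M) ** matP"
    unfolding matrix_mult_diff_left matrix_mult_diff_right
    by (metis assms(2,3) matrix_mul_assoc)
  then show "matP ** (M' ** N' - N' ** M') = matP ** mscale c K'"
    by (simp add: assms(1,4) mscale_mult_left mscale_mult_right)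
qed

lemma comm_eps_A: "epsA ** adjA - adjA ** epsA = mscale (2 * \<i>) dualA"
  by (rule commutator_similar[OF comm_A_dual adjA_matP dualA_matP epsA_matP])

lemma comm_dual_eps: "dualA ** epsA - epsA ** dualA = mscale (2 * \<i>) adjA"
  by (rule commutator_similar[OF comm_eps_A epsA_matP adjA_matP dualA_matP])

text \<open>In each triple, \<open>X\<close> has the first vector of the corresponding part as
  eigenvector, and \<open>Y\<close> provides the idempotent applied to that vector.\<close>

lemma cube_triple_dual_A: "cube_triple dualA adjA epsA"
  by (intro cube_triple.intro comm_A_dual comm_dual_eps comm_eps_A hermitian_adjA hermitian_dualA
    hermitian_epsA cube_spectral_dualA)

lemma cube_triple_eps_dual: "cube_triple epsA dualA adjA"
  by (intro cube_triple.intro comm_A_dual comm_dual_eps comm_eps_A hermitian_adjA hermitian_dualA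
    hermitian_epsA cube_spectral_epsA)

lemma cube_triple_A_eps: "cube_triple adjA epsA dualA"
  by (intro cube_triple.intro comm_A_dual comm_dual_eps comm_eps_A hermitian_adjA hermitian_dualA
    hermitian_epsA cube_spectral_adjA)

interpretation dual_A: cube_triple dualA adjA epsA
  by (rule cube_triple_dual_A)

interpretation eps_dual: cube_triple epsA dualA adjA
  by (rule cube_triple_eps_dual)

interpretation A_eps: cube_triple adjA epsA dualA
  by (rule cube_triple_A_eps)

section \<open>Irreducible modules\<close>

lemma epsA_mult_vector: "epsA *v w = (- \<i> / 2) *s (adjA *v (dualA *v w) - dualA *v (adjA *v w))"
  by (simp add: epsA_def mscale_mult_vector matrix_vector_mult_diff_rdistrib flip: matrix_vector_mul_assoc)

text \<open>The matrices preserving a subspace form a subalgebra, so preservation by the two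
  generators is enough.\<close>

lemma T_module_iff:
  "T_module W \<longleftrightarrow> vec.subspace W \<and> (\<forall>w\<in>W. adjA *v w \<in> W) \<and> (\<forall>w\<in>W. dualA *v w \<in> W)"
proof
  assume "T_module W"
  moreover have "adjA \<in> algT" "dualA \<in> algT"
    unfolding algT_def by (simp_all add: hull_inc)
  ultimately show "vec.subspace W \<and> (\<forall>w\<in>W. adjA *v w \<in> W) \<and> (\<forall>w\<in>W. dualA *v w \<in> W)"
    unfolding T_module_def img_def image_subset_iff by blast
next
  assume W: "vec.subspace W \<and> (\<forall>w\<in>W. adjA *v w \<in> W) \<and> (\<forall>w\<in>W. dualA *v w \<in> W)"
  have "is_subalgebra {B. \<forall>w\<in>W. B *v w \<in> W}"
    using W unfolding is_subalgebra_def
    by (auto simp: mscale_mult_vector matrix_vector_mult_add_rdistrib vec.subspace_add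
        vec.subspace_scale simp flip: matrix_vector_mul_assoc)
  then have "algT \<subseteq> {B. \<forall>w\<in>W. B *v w \<in> W}"
    unfolding algT_def using W by (intro hull_minimal) auto
  then show "T_module W"
    using W unfolding T_module_def img_def image_subset_iff by auto
qed

lemma theta_eq_of_int: "theta TYPE('n::finite) i = of_int (int CARD('n) - 2 * int i)"
  by (simp add: theta_def)

text \<open>Transfers the scalar found through \<open>dualA\<close> to the other two
  triples.\<close>

lemma casimir_permute:
  "eps_dual.casimir w = dual_A.casimir w" "A_eps.casimir w = dual_A.casimir w"
  by (simp_all add: dual_A.casimir_def eps_dual.casimir_def A_eps.casimir_def)

section \<open>Weights and Casimir scalar of an irreducible module\<close>

locale irreducible_cube_module =
  fixes W :: "'n::finite cvec set"
  assumes irreducible: "irreducible_T_module W"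
begin

lemma subspace_W: "vec.subspace W"
  and adjA_W: "w \<in> W \<Longrightarrow> adjA *v w \<in> W"
  and dualA_W: "w \<in> W \<Longrightarrow> dualA *v w \<in> W"
  using irreducible by (auto simp: irreducible_T_module_def T_module_iff)

lemma epsA_W: "w \<in> W \<Longrightarrow> epsA *v w \<in> W"
  unfolding epsA_mult_vector
  by (intro vec.subspace_scale vec.subspace_diff subspace_W adjA_W dualA_W)

lemma dualE_W: "w \<in> W \<Longrightarrow> i \<le> CARD('n) \<Longrightarrow> dualE i *v w \<in> W"
  using lagrange_idem_invariant[OF subspace_W dualA_W] by (metis lagrange_idem_dualA)

lemma raise_W: "w \<in> W \<Longrightarrow> dual_A.raise w \<in> W"
  and lower_W: "w \<in> W \<Longrightarrow> dual_A.lower w \<in> W"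
  unfolding dual_A.raise_def dual_A.lower_def
  by (intro vec.subspace_scale vec.subspace_diff vec.subspace_add subspace_W adjA_W epsA_W; assumption)+

lemma string_W: "w \<in> W \<Longrightarrow> dual_A.string w j \<in> W"
proof -
  assume "w \<in> W"
  then have "(dual_A.lower ^^ j) w \<in> W"
    by (induction j) (auto intro: lower_W)
  then show ?thesis
    unfolding dual_A.string_def by (intro vec.subspace_scale subspace_W)
qed

text \<open>A nonzero vector of the image has a vertex of weight \<open>i\<close> in its support,
  which bounds \<open>i\<close>. For \<open>i = endpoint W\<close> this avoids a separate argument
  that the minimum is attained.\<close>

lemma dualE_image_vector:
  assumes "v \<in> img (dualE i) W" and "v \<noteq> 0"
  shows "i \<le> CARD('n)" and "v \<in> W" and "dualA *v v = theta TYPE('n) i *s v"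
    and "endpoint W \<le> i"
proof -
  obtain w where w: "w \<in> W" "v = dualE i *v w"
    using assms(1) by (auto simp: img_def)
  obtain y where "v $ y \<noteq> 0"
    using assms(2) by (auto simp: vec_eq_iff)
  then have "ones y = i"
    using w(2) by (simp add: dualE_nth split: if_splits)
  then show i: "i \<le> CARD('n)"
    using ones_le by blast
  show "v \<in> W" "dualA *v v = theta TYPE('n) i *s v"
    using w i by (auto simp: dualE_W dualA_dualE)
  show "endpoint W \<le> i"
    unfolding endpoint_def using i assms by (intro Min_le) auto
qed

text \<open>Raising adds 2 to the eigenvalue of \<open>dualA\<close>, hence lowers the distance by
  1, below the endpoint. The eigenvalue is read off at a vertex of the support.\<close>

lemma raise_endpoint_vector:
  assumes "v \<in> img (dualE (endpoint W)) W" and "v \<noteq> 0"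
  shows "dual_A.raise v = 0"
proof (rule ccontr)
  let ?r = "endpoint W" and ?e = "dual_A.raise v"
  assume "?e \<noteq> 0"
  then obtain y where y: "?e $ y \<noteq> 0" by (auto simp: vec_eq_iff)
  note v = dualE_image_vector[OF assms]
  have "dualA *v ?e = (theta TYPE('n) ?r + 2) *s ?e"
    by (simp add: dual_A.X_raise v(3) dual_A.raise_scale vec_eq_iff algebra_simps)
  then have "theta TYPE('n) (ones y) * ?e $ y = (theta TYPE('n) ?r + 2) * ?e $ y"
    by (metis dualA_mult_vector_nth vector_smult_component)
  then have "theta TYPE('n) (ones y) = theta TYPE('n) ?r + 2"
    using y by (simp only: mult_cancel_right) simp
  then have "2 * complex_of_nat ?r = 2 * of_nat (ones y + 1)"
    by (simp add: theta_def algebra_simps)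
  then have r: "?r = ones y + 1"
    by (simp only: mult_cancel_left of_nat_eq_iff) simp
  have "(dualE (ones y) *v ?e) $ y \<noteq> 0"
    using y by (simp add: dualE_nth)
  then have "dualE (ones y) *v ?e \<noteq> 0" by (metis zero_index)
  then have "?r \<le> ones y"
    using raise_W[OF v(2)] by (intro dualE_image_vector(4)[of "dualE (ones y) *v ?e"]) (auto simp: img_def)
  with r show False by simp
qed

lemma endpoint_le_half:
  assumes "v \<in> img (dualE (endpoint W)) W" and "v \<noteq> 0"
  shows "2 * endpoint W \<le> CARD('n)"
  using dual_A.highest_weight_nonneg[OF _ raise_endpoint_vector[OF assms] assms(2)]
    dualE_image_vector(3)[OF assms]
  unfolding theta_eq_of_int by fastforce

text \<open>Schur's argument: the eigenspace of the Casimir operator in \<open>W\<close> is a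
  submodule containing \<open>v\<close>, hence all of \<open>W\<close>.\<close>

lemma casimir_W:
  assumes "v \<in> img (dualE (endpoint W)) W" and "v \<noteq> 0" and "CARD('n) = d + 2 * endpoint W" and "w \<in> W"
  shows "dual_A.casimir w = (of_nat d * (of_nat d + 2)) *s w"
proof -
  let ?U = "{w \<in> W. dual_A.casimir w = (of_nat d * (of_nat d + 2)) *s w}"
  have "T_module ?U"
    unfolding T_module_iff
    by (auto simp: dual_A.casimir_eigenspace_subspace[OF subspace_W] dual_A.casimir_commute
        adjA_W dualA_W vector_scalar_commute)
  moreover have "v \<in> ?U"
    using dual_A.casimir_highest[OF raise_endpoint_vector[OF assms(1,2)] dualE_image_vector(3)[OF assms(1,2)]]
      dualE_image_vector(2)[OF assms(1,2)] by (simp add: theta_def assms(3))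
  ultimately have "?U = W"
    using irreducible assms(2) unfolding irreducible_T_module_def by blast
  then show ?thesis using assms(4) by blast
qed

text \<open>Minimality of the endpoint bounds the occurring indices below,
  \<open>casimir_lower_bound\<close> bounds them above by \<open>r + d\<close>, and the string of
  \<open>v\<close> realizes every index between.\<close>

lemma diameter_eq:
  assumes "v \<in> img (dualE (endpoint W)) W" and "v \<noteq> 0" and "CARD('n) = d + 2 * endpoint W"
  shows "diameter_T W = d"
proof -
  let ?r = "endpoint W"
  note v = dualE_image_vector[OF assms(1,2)] raise_endpoint_vector[OF assms(1,2)]
  have vd: "dualA *v v = of_nat d *s v"
    using v(3) assms(3) by (simp add: theta_def)
  have "{i. i \<le> CARD('n) \<and> img (dualE i) W \<noteq> {0}} = {?r..?r + d}"
  proof (intro set_eqI iffI)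
    fix i assume i: "i \<in> {i. i \<le> CARD('n) \<and> img (dualE i) W \<noteq> {0}}"
    have "0 \<in> img (dualE i) W"
      using vec.subspace_0[OF subspace_W] by (force simp: img_def)
    then obtain w where w: "w \<in> img (dualE i) W" "w \<noteq> 0"
      using i by blast
    note w' = dualE_image_vector[OF w]
    have "- int d \<le> int CARD('n) - 2 * int i"
      using w'(3) unfolding theta_eq_of_int
      by (rule dual_A.casimir_lower_bound[OF casimir_W[OF assms w'(2)]]) (rule w(2))
    then show "i \<in> {?r..?r + d}"
      using w'(4) assms(3) by simp
  next
    fix i assume "i \<in> {?r..?r + d}"
    then obtain j where j: "i = ?r + j" "j \<le> d"
      by (metis atLeastAtMost_iff le_add_diff_inverse add_le_cancel_left)
    let ?s = "dual_A.string v j"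
    have i: "i \<le> CARD('n)" using j assms(3) by simp
    have "dualA *v ?s = theta TYPE('n) i *s ?s"
      using dual_A.X_string[OF vd, of j] by (simp add: theta_def assms(3) j algebra_simps)
    then have "dualE i *v ?s = ?s"
      using lagrange_idem_eigenvector[of dualA ?s i i] i by (simp add: lagrange_idem_dualA)
    then have "?s \<in> img (dualE i) W"
      unfolding img_def by (metis image_eqI string_W v(2))
    moreover have "?s \<noteq> 0"
      by (rule dual_A.string_nonzero[OF vd v(5) assms(2) j(2)])
    ultimately show "i \<in> {i. i \<le> CARD('n) \<and> img (dualE i) W \<noteq> {0}}"
      using i by blast
  qed
  then show ?thesis by (simp add: diameter_T_def)
qed

end

theorem theorem11p5:
  fixes W :: "(complex ^ (bool ^ 'n::finite)) set"
    and r d i j :: nat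
    and u us ue :: "complex ^ (bool ^ 'n)"
  assumes "irreducible_T_module W"
    and "r = endpoint W"
    and "d = diameter_T W"
    and "i \<le> d" and "j \<le> d"
    and "u \<in> img (idE r) W" and "u \<noteq> 0"
    and "us \<in> img (dualE r) W" and "us \<noteq> 0"
    and "ue \<in> img (epsE r) W" and "ue \<noteq> 0"
  shows "herm (idE (r + i) *v us) (dualE (r + j) *v u)
           = 1 / 2 ^ d * herm us u * of_nat (d choose i) * of_nat (d choose j) * hyp2F1 d i j
    \<and> herm (dualE (r + i) *v ue) (epsE (r + j) *v us)
           = 1 / 2 ^ d * herm ue us * of_nat (d choose i) * of_nat (d choose j) * hyp2F1 d i j
    \<and> herm (epsE (r + i) *v u) (idE (r + j) *v ue)
           = 1 / 2 ^ d * herm u ue * of_nat (d choose i) * of_nat (d choose j) * hyp2F1 d i j"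
proof -
  interpret irreducible_cube_module W
    by unfold_locales (rule assms(1))
  have us: "us \<in> img (dualE (endpoint W)) W"
    using assms(2,8) by simp
  \<comment> \<open>The highest weight, not yet known to be the diameter; \<open>diameter_eq\<close>
    then identifies it with \<open>d\<close>.\<close>
  obtain d' where d': "CARD('n) = d' + 2 * r"
    using endpoint_le_half[OF us assms(9)] assms(2) by (metis le_iff_add add.commute)
  then have D: "CARD('n) = d + 2 * r" "CARD('n) = d + 2 * endpoint W"
    using diameter_eq[OF us assms(9)] assms(2,3) by auto
  then have le: "r \<le> CARD('n)" "r + i \<le> CARD('n)" "r + j \<le> CARD('n)"
    using assms(4,5) by simp_all
  have theta: "theta TYPE('n) r = of_nat d"
    by (simp add: theta_def D(1))
  have idem: "lagrange_idem X r *v w \<in> W \<and>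
      X *v (lagrange_idem X r *v w) = of_nat d *s (lagrange_idem X r *v w)"
    if "w \<in> W" "cube_spectral X" "\<And>w. w \<in> W \<Longrightarrow> X *v w \<in> W" for X and w :: "'n cvec"
    using lagrange_idem_invariant[OF subspace_W that(3,1)]
      cube_spectral_decomposition(2)[OF that(2) le(1)] theta by simp
  have u: "u \<in> W" "adjA *v u = of_nat d *s u"
    using assms(6) idem[OF _ cube_spectral_adjA adjA_W]
    by (auto simp: img_def lagrange_idem_adjA)
  have us': "us \<in> W" "dualA *v us = of_nat d *s us"
    using assms(8) idem[OF _ cube_spectral_dualA dualA_W]
    by (auto simp: img_def lagrange_idem_dualA le)
  have ue: "ue \<in> W" "epsA *v ue = of_nat d *s ue"
    using assms(10) idem[OF _ cube_spectral_epsA epsA_W]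
    by (auto simp: img_def lagrange_idem_epsA le)
  \<comment> \<open>The three vectors lie in \<open>W\<close> with weight \<open>d\<close>, so the
    common Casimir scalar makes each a highest weight vector of its own triple.\<close>
  note cas = casimir_W[OF us assms(9) D(2)]
  have "dual_A.raise us = 0"
    by (rule dual_A.raise_eq_zero[OF cas[OF us'(1)] us'(2)])
  moreover have "eps_dual.raise ue = 0"
    by (rule eps_dual.raise_eq_zero[OF cas[OF ue(1), folded casimir_permute(1)] ue(2)])
  moreover have "A_eps.raise u = 0"
    by (rule A_eps.raise_eq_zero[OF cas[OF u(1), folded casimir_permute(2)] u(2)])
  ultimately show ?thesis
    using dual_A.herm_lagrange_idem[OF us'(2) _ u(2) D(1) assms(4,5)]
      eps_dual.herm_lagrange_idem[OF ue(2) _ us'(2) D(1) assms(4,5)]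
      A_eps.herm_lagrange_idem[OF u(2) _ ue(2) D(1) assms(4,5)]
    by (simp add: lagrange_idem_adjA lagrange_idem_dualA lagrange_idem_epsA le)
qed

end
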